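(* Let $(\mathcal{X}, d_{\mathcal{X}})$ be a non-empty compact metric space with diameter $D_{\mathcal{X}}>0$, let $(x_n)_{n\in\mathbb{N}}$ be a basis of $\mathcal{X}$, let $q>1$, and let $$\varphi : \mathcal{X}\longrightarrow \ell^2,\qquad x\longmapsto \left(\frac{c_\varphi\, d_{\mathcal{X}}(x,x_n)}{q^n}\right)_{n\in\mathbb{N}},\qquad c_\varphi := \frac{\sqrt{q^2-1}}{q}.$$ Let $V := \varphi(\mathcal{X})\subset \ell^2$, let $W$ be a compact subset of $\ell^2$ containing $V$, and let $k_W : W^2\longrightarrow\mathbb{R}$ be a universal kernel on $W$. Then the kernel $$k : \mathcal{X}^2\longrightarrow\mathbb{R},\qquad (x,y)\longmapsto k_W(\varphi(x),\varphi(y))$$ is universal on $\mathcal{X}$.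
   Context: $\mathbb{N}$ includes $0$. A basis of $\mathcal{X}$ is a sequence $(x_n)_{n\in\mathbb{N}}$ of points of $\mathcal{X}$ (repetitions allowed) such that for every $x\in\mathcal{X}$ and $\varepsilon>0$ there is $n\in\mathbb{N}$ with $d_{\mathcal{X}}(x,x_n)\le\varepsilon$. $\ell^2$ is the Hilbert space of real square-summable sequences indexed by $\mathbb{N}$, and subsets of it carry the induced metric. A kernel on a set $E$ is a symmetric function $k:E\times E\to\mathbb{R}$ such that $\sum_{i,j=1}^n a_i k(x_i,x_j)a_j\ge 0$ for all $n\ge1$, $x_1,\dots,x_n\in E$ and $a\in\mathbb{R}^n$; it has a unique associated Reproducing Kernel Hilbert Space (RKHS), a Hilbert space $H$ of functions $E\to\mathbb{R}$ containing all $k(\cdot,x)$ with $\langle h,k(\cdot,x)\rangle_H = h(x)$ for all $h\in H$, $x\in E$. A continuous kernel on a compact metric space $E$ is universal if its RKHS is dense in the space $\mathcal{C}(E)$ of continuous functions $E\to\mathbb{R}$ equipped with the supremum norm (a universal kernel is in particular continuous). *)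

theory Defs
  imports "HOL-Analysis.Analysis"
begin

section \<open>The Hilbert space of real square-summable sequences\<close>

typedef ell2 = "{f :: nat \<Rightarrow> real. summable (\<lambda>n. (f n)\<^sup>2)}"
  morphisms ell2_nth Abs_ell2
  by (rule exI[of _ "\<lambda>_. 0"]) simp

setup_lifting type_definition_ell2

lemma summable_ell2_nth: "summable (\<lambda>n. (ell2_nth f n)\<^sup>2)"
  using ell2_nth by blast

lemma ell2_nth_Abs: "summable (\<lambda>n. (f n)\<^sup>2) \<Longrightarrow> ell2_nth (Abs_ell2 f) = f"
  by (simp add: Abs_ell2_inverse)

lemma ell2_eqI: "(\<And>n. ell2_nth f n = ell2_nth g n) \<Longrightarrow> f = g"
  using ell2_nth_inject by blast

lemma summable_mult_squares:
  fixes f g :: "nat \<Rightarrow> real"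
  assumes "summable (\<lambda>n. (f n)\<^sup>2)" "summable (\<lambda>n. (g n)\<^sup>2)"
  shows "summable (\<lambda>n. f n * g n)"
proof (rule summable_comparison_test')
  show "summable (\<lambda>n. (f n)\<^sup>2 + (g n)\<^sup>2)"
    using assms by (rule summable_add)
  show "norm (f n * g n) \<le> (f n)\<^sup>2 + (g n)\<^sup>2" for n
  proof -
    have "2 * (\<bar>f n\<bar> * \<bar>g n\<bar>) \<le> (f n)\<^sup>2 + (g n)\<^sup>2"
      using sum_squares_bound[of "\<bar>f n\<bar>" "\<bar>g n\<bar>"] by (simp add: mult.assoc)
    moreover have "0 \<le> \<bar>f n\<bar> * \<bar>g n\<bar>" by simp
    ultimately show ?thesis by (simp only: real_norm_def abs_mult)
  qed
qed

lemma summable_square_add: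
  fixes f g :: "nat \<Rightarrow> real"
  assumes "summable (\<lambda>n. (f n)\<^sup>2)" "summable (\<lambda>n. (g n)\<^sup>2)"
  shows "summable (\<lambda>n. (f n + g n)\<^sup>2)"
proof -
  have "summable (\<lambda>n. (f n)\<^sup>2 + (g n)\<^sup>2 + 2 * (f n * g n))"
    by (intro summable_add summable_mult summable_mult_squares assms)
  then show ?thesis by (simp add: power2_sum mult.assoc)
qed

instantiation ell2 :: real_vector
begin

lift_definition zero_ell2 :: ell2 is "\<lambda>_. 0" by simp

lift_definition plus_ell2 :: "ell2 \<Rightarrow> ell2 \<Rightarrow> ell2" is "\<lambda>f g n. f n + g n"
  by (rule summable_square_add)

lift_definition uminus_ell2 :: "ell2 \<Rightarrow> ell2" is "\<lambda>f n. - f n" by simp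

lift_definition minus_ell2 :: "ell2 \<Rightarrow> ell2 \<Rightarrow> ell2" is "\<lambda>f g n. f n - g n"
  using summable_square_add[of _ "\<lambda>n. - _ n"] by simp

lift_definition scaleR_ell2 :: "real \<Rightarrow> ell2 \<Rightarrow> ell2" is "\<lambda>c f n. c * f n"
  by (simp add: power_mult_distrib summable_mult)

instance
  by standard (transfer; simp add: algebra_simps)+

end

instantiation ell2 :: real_inner
begin

lift_definition inner_ell2 :: "ell2 \<Rightarrow> ell2 \<Rightarrow> real" is "\<lambda>f g. \<Sum>n. f n * g n" .

definition norm_ell2 :: "ell2 \<Rightarrow> real" where
  "norm_ell2 f = sqrt (inner f f)"

definition dist_ell2 :: "ell2 \<Rightarrow> ell2 \<Rightarrow> real" where
  "dist_ell2 f g = norm (f - g)"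

definition sgn_ell2 :: "ell2 \<Rightarrow> ell2" where
  "sgn_ell2 f = f /\<^sub>R norm f"

definition uniformity_ell2 :: "(ell2 \<times> ell2) filter" where
  "uniformity_ell2 = (INF e\<in>{0<..}. principal {(x, y). dist x y < e})"

definition open_ell2 :: "ell2 set \<Rightarrow> bool" where
  "open_ell2 U \<longleftrightarrow> (\<forall>x\<in>U. \<forall>\<^sub>F (x', y) in uniformity. x' = x \<longrightarrow> y \<in> U)"

instance
proof
  fix x y z :: ell2 and r :: real and U :: "ell2 set"
  show "dist x y = norm (x - y)" by (rule dist_ell2_def)
  show "sgn x = x /\<^sub>R norm x" by (rule sgn_ell2_def)
  show "uniformity = (INF e\<in>{0<..}. principal {(x :: ell2, y). dist x y < e})"
    by (rule uniformity_ell2_def)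
  show "open U \<longleftrightarrow> (\<forall>x\<in>U. \<forall>\<^sub>F (x', y) in uniformity. x' = x \<longrightarrow> y \<in> U)"
    by (rule open_ell2_def)
  show "inner x y = inner y x" by transfer (simp add: mult.commute)
  show "inner (x + y) z = inner x z + inner y z"
    by transfer (simp add: algebra_simps suminf_add summable_mult_squares)
  show "inner (r *\<^sub>R x) y = r * inner x y"
    by transfer (simp add: mult.assoc suminf_mult summable_mult_squares)
  show "0 \<le> inner x x"
    by transfer (simp add: suminf_nonneg flip: power2_eq_square)
  show "inner x x = 0 \<longleftrightarrow> x = 0"
    by transfer (simp add: suminf_eq_zero_iff fun_eq_iff flip: power2_eq_square)
  show "norm x = sqrt (inner x x)" by (rule norm_ell2_def)
qed

end

lemma norm_ell2_eq: "norm f = sqrt (\<Sum>n. (ell2_nth f n)\<^sup>2)"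
  by (simp add: norm_ell2_def inner_ell2.rep_eq power2_eq_square)

lemma dist_ell2_eq: "dist f g = sqrt (\<Sum>n. (ell2_nth f n - ell2_nth g n)\<^sup>2)"
  by (simp add: dist_ell2_def norm_ell2_eq minus_ell2.rep_eq)

lemma sum_le_norm_ell2: "(\<Sum>n<N. (ell2_nth f n)\<^sup>2) \<le> (norm f)\<^sup>2"
proof -
  have "(\<Sum>n<N. (ell2_nth f n)\<^sup>2) \<le> (\<Sum>n. (ell2_nth f n)\<^sup>2)"
    by (intro sum_le_suminf summable_ell2_nth) auto
  also have "\<dots> = (norm f)\<^sup>2"
    by (simp add: norm_ell2_eq suminf_nonneg summable_ell2_nth)
  finally show ?thesis .
qed

lemma abs_ell2_nth_le_norm: "\<bar>ell2_nth f n\<bar> \<le> norm f"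
proof -
  have "(ell2_nth f n)\<^sup>2 \<le> (\<Sum>k<Suc n. (ell2_nth f k)\<^sup>2)"
    by (simp add: sum_nonneg)
  also have "\<dots> \<le> (norm f)\<^sup>2" by (rule sum_le_norm_ell2)
  finally show ?thesis by (simp add: abs_le_square_iff[symmetric])
qed

instance ell2 :: banach
proof
  fix X :: "nat \<Rightarrow> ell2"
  assume X: "Cauchy X"
  have "Cauchy (\<lambda>i. ell2_nth (X i) n)" for n
  proof (rule metric_CauchyI)
    fix e :: real assume "0 < e"
    then obtain M where M: "\<forall>i\<ge>M. \<forall>j\<ge>M. dist (X i) (X j) < e"
      using X by (meson metric_CauchyD)
    have "dist (ell2_nth (X i) n) (ell2_nth (X j) n) \<le> dist (X i) (X j)" for i j
      using abs_ell2_nth_le_norm[of "X i - X j" n]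
      by (simp add: dist_ell2_def dist_real_def minus_ell2.rep_eq)
    then show "\<exists>M. \<forall>i\<ge>M. \<forall>j\<ge>M. dist (ell2_nth (X i) n) (ell2_nth (X j) n) < e"
      using M by (meson le_less_trans)
  qed
  then have "\<exists>l. (\<lambda>i. ell2_nth (X i) n) \<longlonglongrightarrow> l" for n
    by (simp add: Cauchy_convergent_iff convergent_def)
  then obtain l where l: "\<And>n. (\<lambda>i. ell2_nth (X i) n) \<longlonglongrightarrow> l n"
    by metis
  have bound: "summable (\<lambda>n. (ell2_nth (X i) n - l n)\<^sup>2) \<and>
      (\<Sum>n. (ell2_nth (X i) n - l n)\<^sup>2) \<le> e\<^sup>2"
    if e: "0 < e" and M: "\<forall>i\<ge>M. \<forall>j\<ge>M. dist (X i) (X j) < e" and i: "i \<ge> M" for e M i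
  proof -
    have fin: "(\<Sum>n<N. (ell2_nth (X i) n - l n)\<^sup>2) \<le> e\<^sup>2" for N
    proof (rule LIMSEQ_le_const2)
      show "(\<lambda>j. \<Sum>n<N. (ell2_nth (X i) n - ell2_nth (X j) n)\<^sup>2)
          \<longlonglongrightarrow> (\<Sum>n<N. (ell2_nth (X i) n - l n)\<^sup>2)"
        by (intro tendsto_intros l)
      have "(\<Sum>n<N. (ell2_nth (X i) n - ell2_nth (X j) n)\<^sup>2) \<le> e\<^sup>2" if "j \<ge> M" for j
      proof -
        have "(\<Sum>n<N. (ell2_nth (X i) n - ell2_nth (X j) n)\<^sup>2) \<le> (norm (X i - X j))\<^sup>2"
          using sum_le_norm_ell2[of "X i - X j" N] by (simp add: minus_ell2.rep_eq)
        also have "\<dots> \<le> e\<^sup>2"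
          using M i that by (intro power_mono) (auto simp: dist_ell2_def intro: less_imp_le)
        finally show ?thesis .
      qed
      then show "\<exists>K. \<forall>j\<ge>K. (\<Sum>n<N. (ell2_nth (X i) n - ell2_nth (X j) n)\<^sup>2) \<le> e\<^sup>2"
        by blast
    qed
    have s: "summable (\<lambda>n. (ell2_nth (X i) n - l n)\<^sup>2)"
      by (rule bounded_imp_summable[where B = "e\<^sup>2"]) (auto simp: fin simp del: sum.lessThan_Suc simp flip: lessThan_Suc_atMost)
    moreover have "(\<Sum>n. (ell2_nth (X i) n - l n)\<^sup>2) \<le> e\<^sup>2"
      by (rule suminf_le_const[OF s]) (rule fin)
    ultimately show ?thesis by blast
  qed
  obtain M0 where M0: "\<forall>i\<ge>M0. \<forall>j\<ge>M0. dist (X i) (X j) < 1"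
    using X by (meson metric_CauchyD zero_less_one)
  have "summable (\<lambda>n. (- (ell2_nth (X M0) n - l n))\<^sup>2)"
    using bound[OF _ M0, of M0] by (simp only: power2_minus)
  from summable_square_add[OF summable_ell2_nth[of "X M0"] this]
  have "summable (\<lambda>n. (l n)\<^sup>2)" by simp
  then have L: "ell2_nth (Abs_ell2 l) = l" by (rule ell2_nth_Abs)
  have "X \<longlonglongrightarrow> Abs_ell2 l"
  proof (rule metric_LIMSEQ_I)
    fix r :: real assume r: "0 < r"
    then obtain M where M: "\<forall>i\<ge>M. \<forall>j\<ge>M. dist (X i) (X j) < r / 2"
      using X by (meson metric_CauchyD half_gt_zero)
    have "dist (X i) (Abs_ell2 l) < r" if "i \<ge> M" for i
    proof -
      have "dist (X i) (Abs_ell2 l) \<le> r / 2"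
        unfolding dist_ell2_eq L
        using bound[OF _ M that] r by (intro real_le_lsqrt) auto
      then show ?thesis using r by linarith
    qed
    then show "\<exists>no. \<forall>i\<ge>no. dist (X i) (Abs_ell2 l) < r" by blast
  qed
  then show "convergent X" by (rule convergentI)
qed


section \<open>The embedding\<close>

definition is_basis :: "'a::metric_space set \<Rightarrow> (nat \<Rightarrow> 'a) \<Rightarrow> bool" where
  "is_basis X xs \<longleftrightarrow> range xs \<subseteq> X \<and> (\<forall>x\<in>X. \<forall>\<epsilon>>0. \<exists>n. dist x (xs n) \<le> \<epsilon>)"

definition c_phi :: "real \<Rightarrow> real" where
  "c_phi q = sqrt (q\<^sup>2 - 1) / q"

definition phi :: "real \<Rightarrow> (nat \<Rightarrow> 'a::metric_space) \<Rightarrow> 'a \<Rightarrow> ell2" where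
  "phi q xs x = Abs_ell2 (\<lambda>n. c_phi q * dist x (xs n) / q ^ n)"

text \<open>The sequence in the definition of \<^const>\<open>phi\<close> is square-summable in the case of interest,
  so that its coordinates are the intended ones.\<close>

lemma ell2_nth_phi:
  fixes xs :: "nat \<Rightarrow> 'a::metric_space"
  assumes "bounded (range xs)" "q > 1"
  shows "ell2_nth (phi q xs x) n = c_phi q * dist x (xs n) / q ^ n"
proof -
  obtain B where B: "\<And>n. dist x (xs n) \<le> B"
    using assms(1) by (auto simp: bounded_any_center[where a = x])
  have "summable (\<lambda>n. (c_phi q * dist x (xs n) / q ^ n)\<^sup>2)"
  proof (rule summable_comparison_test')
    show "summable (\<lambda>n. (c_phi q * B)\<^sup>2 * (1 / q\<^sup>2) ^ n)"
      using assms(2) by (intro summable_mult summable_geometric) (simp add: one_less_power)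
    show "norm ((c_phi q * dist x (xs n) / q ^ n)\<^sup>2) \<le> (c_phi q * B)\<^sup>2 * (1 / q\<^sup>2) ^ n" for n
    proof -
      have "(dist x (xs n))\<^sup>2 \<le> B\<^sup>2" by (intro power_mono B) simp
      then have "(c_phi q)\<^sup>2 * (dist x (xs n))\<^sup>2 / (q ^ n)\<^sup>2 \<le> (c_phi q)\<^sup>2 * B\<^sup>2 / (q ^ n)\<^sup>2"
        by (intro divide_right_mono mult_left_mono) auto
      moreover have "(q ^ n)\<^sup>2 = (q\<^sup>2) ^ n"
        by (simp add: mult.commute flip: power_mult)
      ultimately show ?thesis
        by (simp add: power_mult_distrib power_divide)
    qed
  qed
  then show ?thesis by (simp add: phi_def ell2_nth_Abs)
qed


section \<open>Kernels, reproducing kernel Hilbert spaces and universality\<close>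

text \<open>Kernels on \<open>E\<close> are total functions of which only the values on \<open>E \<times> E\<close> matter.\<close>

definition kernel_on :: "'a set \<Rightarrow> ('a \<Rightarrow> 'a \<Rightarrow> real) \<Rightarrow> bool" where
  "kernel_on E k \<longleftrightarrow>
     (\<forall>x\<in>E. \<forall>y\<in>E. k x y = k y x) \<and>
     (\<forall>n\<ge>1. \<forall>(x :: nat \<Rightarrow> 'a) (a :: nat \<Rightarrow> real). (\<forall>i\<in>{1..n}. x i \<in> E) \<longrightarrow>
        0 \<le> (\<Sum>i=1..n. \<Sum>j=1..n. a i * k (x i) (x j) * a j))"

text \<open>A function from \<open>E\<close> to the reals is represented by its extension by \<open>0\<close> outside \<open>E\<close>,
  so that equality of representatives is equality on \<open>E\<close> and the representatives form a
  linear space.\<close>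

definition zero_ext :: "'a set \<Rightarrow> ('a \<Rightarrow> real) \<Rightarrow> 'a \<Rightarrow> real" where
  "zero_ext E f = (\<lambda>x. if x \<in> E then f x else 0)"

definition functions_on :: "'a set \<Rightarrow> ('a \<Rightarrow> real) set" where
  "functions_on E = {f. \<forall>x. x \<notin> E \<longrightarrow> f x = 0}"

text \<open>A Hilbert space \<open>H\<close> of functions on \<open>E\<close> (with pointwise operations), with inner
  product \<open>ip\<close>, of which only the values on \<open>H \<times> H\<close> matter.\<close>

locale hilbert_function_space =
  fixes E :: "'a set" and H :: "('a \<Rightarrow> real) set" and ip :: "('a \<Rightarrow> real) \<Rightarrow> ('a \<Rightarrow> real) \<Rightarrow> real"
  assumes subset_functions: "H \<subseteq> functions_on E"
    and zero_mem: "(\<lambda>_. 0) \<in> H"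
    and add_mem: "\<And>f g. f \<in> H \<Longrightarrow> g \<in> H \<Longrightarrow> (\<lambda>x. f x + g x) \<in> H"
    and scale_mem: "\<And>c f. f \<in> H \<Longrightarrow> (\<lambda>x. c * f x) \<in> H"
    and ip_commute: "\<And>f g. f \<in> H \<Longrightarrow> g \<in> H \<Longrightarrow> ip f g = ip g f"
    and ip_add_left: "\<And>f g h. f \<in> H \<Longrightarrow> g \<in> H \<Longrightarrow> h \<in> H \<Longrightarrow>
          ip (\<lambda>x. f x + g x) h = ip f h + ip g h"
    and ip_scale_left: "\<And>c f g. f \<in> H \<Longrightarrow> g \<in> H \<Longrightarrow> ip (\<lambda>x. c * f x) g = c * ip f g"
    and ip_nonneg: "\<And>f. f \<in> H \<Longrightarrow> 0 \<le> ip f f"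
    and ip_eq_0: "\<And>f. f \<in> H \<Longrightarrow> ip f f = 0 \<Longrightarrow> f = (\<lambda>_. 0)"
    and complete: "\<And>F :: nat \<Rightarrow> 'a \<Rightarrow> real.
          (\<And>n. F n \<in> H) \<Longrightarrow>
          (\<And>\<epsilon>. \<epsilon> > 0 \<Longrightarrow>
             \<exists>N. \<forall>m\<ge>N. \<forall>n\<ge>N. sqrt (ip (\<lambda>x. F m x - F n x) (\<lambda>x. F m x - F n x)) < \<epsilon>) \<Longrightarrow>
          \<exists>f\<in>H. (\<lambda>n. sqrt (ip (\<lambda>x. F n x - f x) (\<lambda>x. F n x - f x))) \<longlonglongrightarrow> 0"

locale rkhs = hilbert_function_space E H ip
  for E :: "'a set" and k :: "'a \<Rightarrow> 'a \<Rightarrow> real" and H ip +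
  assumes section_mem: "\<And>x. x \<in> E \<Longrightarrow> zero_ext E (\<lambda>y. k y x) \<in> H"
    and reproducing: "\<And>h x. h \<in> H \<Longrightarrow> x \<in> E \<Longrightarrow> ip h (zero_ext E (\<lambda>y. k y x)) = h x"

definition C_on :: "'a::topological_space set \<Rightarrow> ('a \<Rightarrow> real) set" where
  "C_on E = {f \<in> functions_on E. continuous_on E f}"

text \<open>The supremum norm on \<^term>\<open>C_on E\<close>, for compact and non-empty \<open>E\<close>.\<close>

definition sup_norm_on :: "'a set \<Rightarrow> ('a \<Rightarrow> real) \<Rightarrow> real" where
  "sup_norm_on E f = (SUP x\<in>E. \<bar>f x\<bar>)"

definition dense_in_C :: "'a::topological_space set \<Rightarrow> ('a \<Rightarrow> real) set \<Rightarrow> bool" where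
  "dense_in_C E H \<longleftrightarrow>
     H \<subseteq> C_on E \<and> (\<forall>f\<in>C_on E. \<forall>\<epsilon>>0. \<exists>h\<in>H. sup_norm_on E (\<lambda>x. f x - h x) < \<epsilon>)"

text \<open>A kernel has exactly one reproducing kernel Hilbert space (Moore--Aronszajn), so the
  existential quantifier below refers to that space. The notion is meant for compact non-empty
  \<open>E\<close>.\<close>

definition universal_kernel :: "'a::topological_space set \<Rightarrow> ('a \<Rightarrow> 'a \<Rightarrow> real) \<Rightarrow> bool" where
  "universal_kernel E k \<longleftrightarrow>
     kernel_on E k \<and>
     continuous_on (E \<times> E) (\<lambda>(x, y). k x y) \<and>
     (\<exists>H ip. rkhs E k H ip \<and> dense_in_C E H)"

end

theory Submission
  imports Defs
begin

text \<open>The functions \<open>h \<circ> \<phi>\<close>, with \<open>h\<close> in the RKHS of the kernel on \<open>W\<close>, form the RKHS of the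
  pulled-back kernel: each of them has a unique representative \<open>h\<close> orthogonal to all functions
  vanishing on \<open>\<phi>(X)\<close>, namely the one of minimal norm, and the inner product is computed on these
  representatives. The map \<open>\<phi>\<close> is continuous (even 1-Lipschitz) and injective, because a point is
  determined by its distances to a basis. Hence the functions \<open>g \<circ> \<phi>\<close> with \<open>g\<close> continuous on \<open>W\<close>
  form a point-separating algebra, which is dense by Stone--Weierstrass; approximating \<open>g\<close> on \<open>W\<close> by
  elements of the RKHS finishes the proof.\<close>

section \<open>Hilbert spaces of functions\<close>

context hilbert_function_space
begin

lemma diff_mem:
  assumes "f \<in> H" "g \<in> H"
  shows "(\<lambda>x. f x - g x) \<in> H"
  using add_mem[OF assms(1) scale_mem[OF assms(2), of "-1"]] by simp

lemma ip_diff_left: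
  assumes "f \<in> H" "g \<in> H" "h \<in> H"
  shows "ip (\<lambda>x. f x - g x) h = ip f h - ip g h"
  using ip_add_left[OF assms(1) scale_mem[OF assms(2), of "-1"] assms(3)]
    ip_scale_left[OF assms(2,3), of "-1"] by simp

text \<open>This one quadratic in \<open>t\<close> serves every later norm computation:
  \<open>t = 1\<close> and \<open>t = -1\<close> give sums and differences, and a free
  \<open>t\<close> gives the variational arguments.\<close>

lemma ip_add_scale:
  assumes "f \<in> H" "g \<in> H"
  shows "ip (\<lambda>x. f x + t * g x) (\<lambda>x. f x + t * g x) = ip f f + 2 * t * ip f g + t\<^sup>2 * ip g g"
proof -
  let ?s = "\<lambda>x. f x + t * g x"
  have g': "(\<lambda>x. t * g x) \<in> H" and s: "?s \<in> H"
    using assms by (auto intro: scale_mem add_mem)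
  have *: "ip ?s h = ip f h + t * ip g h" if "h \<in> H" for h
    using ip_add_left[OF assms(1) g' that] ip_scale_left[OF assms(2) that] by simp
  have "ip ?s ?s = ip ?s f + t * ip ?s g"
    using *[OF s] ip_commute[OF assms(1) s] ip_commute[OF assms(2) s] by simp
  also have "\<dots> = ip f f + 2 * t * ip f g + t\<^sup>2 * ip g g"
    using *[OF assms(1)] *[OF assms(2)] ip_commute[OF assms]
    by (simp add: algebra_simps power2_eq_square)
  finally show ?thesis .
qed

lemma ip_zero_right: "f \<in> H \<Longrightarrow> ip f (\<lambda>_. 0) = 0"
  using ip_scale_left[OF zero_mem, of f 0] ip_commute[OF zero_mem, of f] by simp

lemma Cauchy_Schwarz:
  assumes "f \<in> H" "g \<in> H"
  shows "\<bar>ip f g\<bar> \<le> sqrt (ip f f) * sqrt (ip g g)"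
proof (cases "ip g g = 0")
  case True
  then have "ip f g = 0"
    using ip_eq_0[OF assms(2)] ip_zero_right[OF assms(1)] by simp
  then show ?thesis by (simp add: ip_nonneg assms)
next
  case False
  then have pos: "0 < ip g g" using ip_nonneg[OF assms(2)] by simp
  \<comment> \<open>This \<open>t\<close> minimises the quadratic of \<open>ip_add_scale\<close>;
    nonnegativity of the minimum is the claimed inequality.\<close>
  define t where "t = - ip f g / ip g g"
  have "0 \<le> ip f f + 2 * t * ip f g + t\<^sup>2 * ip g g"
    using ip_add_scale[OF assms, of t] ip_nonneg[OF add_mem[OF assms(1) scale_mem[OF assms(2)]]]
    by metis
  also have "\<dots> = ip f f - (ip f g)\<^sup>2 / ip g g"
    using pos by (simp add: t_def field_simps power2_eq_square)
  finally have "(ip f g)\<^sup>2 \<le> ip f f * ip g g"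
    using pos by (simp add: field_simps)
  then have "sqrt ((ip f g)\<^sup>2) \<le> sqrt (ip f f * ip g g)" by (rule real_sqrt_le_mono)
  then show ?thesis by (simp add: real_sqrt_mult)
qed

text \<open>Norm convergence implies weak convergence, by Cauchy-Schwarz. Through it, orthogonality
  relations and point evaluations pass to limits.\<close>

lemma ip_tendsto:
  assumes F: "\<And>n. F n \<in> H" and "f \<in> H" "g \<in> H"
    and lim: "(\<lambda>n. sqrt (ip (\<lambda>x. F n x - f x) (\<lambda>x. F n x - f x))) \<longlonglongrightarrow> 0"
  shows "(\<lambda>n. ip (F n) g) \<longlonglongrightarrow> ip f g"
proof (rule LIM_zero_cancel, rule Lim_null_comparison)
  show "\<forall>\<^sub>F n in sequentially. norm (ip (F n) g - ip f g)
      \<le> sqrt (ip (\<lambda>x. F n x - f x) (\<lambda>x. F n x - f x)) * sqrt (ip g g)"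
    using Cauchy_Schwarz[OF diff_mem[OF F \<open>f \<in> H\<close>] \<open>g \<in> H\<close>]
    by (simp add: ip_diff_left F assms(2,3))
  show "(\<lambda>n. sqrt (ip (\<lambda>x. F n x - f x) (\<lambda>x. F n x - f x)) * sqrt (ip g g)) \<longlonglongrightarrow> 0"
    by (rule tendsto_mult_left_zero[OF lim])
qed

text \<open>Expanding the square of \<open>F n - f\<close> expresses \<open>ip (F n) (F n)\<close>
  through the squared distance, which tends to 0, and \<open>ip (F n) f\<close>, which converges
  weakly.\<close>

lemma ip_self_tendsto:
  assumes F: "\<And>n. F n \<in> H" and f: "f \<in> H"
    and lim: "(\<lambda>n. sqrt (ip (\<lambda>x. F n x - f x) (\<lambda>x. F n x - f x))) \<longlonglongrightarrow> 0"
  shows "(\<lambda>n. ip (F n) (F n)) \<longlonglongrightarrow> ip f f"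
proof -
  have D: "ip (\<lambda>x. F n x - f x) (\<lambda>x. F n x - f x) = ip (F n) (F n) - 2 * ip (F n) f + ip f f" for n
    using ip_add_scale[OF F f, of n "-1"] by simp
  have "(\<lambda>n. (sqrt (ip (\<lambda>x. F n x - f x) (\<lambda>x. F n x - f x)))\<^sup>2 + 2 * ip (F n) f - ip f f)
      \<longlonglongrightarrow> 0\<^sup>2 + 2 * ip f f - ip f f"
    by (intro tendsto_intros lim ip_tendsto F f)
  moreover have "(sqrt (ip (\<lambda>x. F n x - f x) (\<lambda>x. F n x - f x)))\<^sup>2 + 2 * ip (F n) f - ip f f
      = ip (F n) (F n)" for n
    using ip_nonneg[OF diff_mem[OF F f], of n] by (simp add: D)
  ultimately show ?thesis by simp
qed

text \<open>Uniform convexity: a minimising sequence of a midpoint-convex set is Cauchy.\<close>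

lemma min_norm_exists:
  assumes "A \<subseteq> H" "A \<noteq> {}"
    and mid: "\<And>f g. f \<in> A \<Longrightarrow> g \<in> A \<Longrightarrow> (\<lambda>x. (f x + g x) / 2) \<in> A"
    and closed: "\<And>F f. (\<And>n. F n \<in> A) \<Longrightarrow> f \<in> H \<Longrightarrow>
        (\<lambda>n. sqrt (ip (\<lambda>x. F n x - f x) (\<lambda>x. F n x - f x))) \<longlonglongrightarrow> 0 \<Longrightarrow> f \<in> A"
  obtains f where "f \<in> A" "\<And>g. g \<in> A \<Longrightarrow> ip f f \<le> ip g g"
proof -
  define d where "d = (INF g\<in>A. ip g g)"
  have bdd: "bdd_below ((\<lambda>g. ip g g) ` A)"
    using assms(1) ip_nonneg by (intro bdd_belowI2[of _ 0]) auto
  have d_le: "d \<le> ip g g" if "g \<in> A" for g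
    unfolding d_def by (rule cINF_lower[OF bdd that])
  have "\<exists>g\<in>A. ip g g < d + 1 / Suc n" for n
    using cINF_less_iff[OF assms(2) bdd, of "d + 1 / Suc n"] by (simp add: d_def)
  then obtain F where F: "\<And>n. F n \<in> A" and Fd: "\<And>n. ip (F n) (F n) < d + 1 / Suc n"
    by metis
  have FH: "F n \<in> H" for n using F assms(1) by auto
  \<comment> \<open>Parallelogram law: the squared distance is twice the sum of both squared norms
    minus four times that of the midpoint. The midpoint lies in \<open>A\<close>, so the latter is
    at least \<open>d\<close>, and the multiples of \<open>d\<close> cancel.\<close>
  have para: "ip (\<lambda>x. F m x - F n x) (\<lambda>x. F m x - F n x) < 2 / Suc m + 2 / Suc n" for m n
  proof -
    let ?s = "\<lambda>x. F m x + F n x"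
    have "ip (\<lambda>x. 1/2 * ?s x) (\<lambda>x. 1/2 * ?s x) = 1/4 * ip ?s ?s"
      using ip_add_scale[OF zero_mem add_mem[OF FH[of m] FH[of n]], of "1/2"]
        ip_zero_right[OF zero_mem] ip_zero_right[OF add_mem[OF FH[of m] FH[of n]]]
        ip_commute[OF zero_mem add_mem[OF FH[of m] FH[of n]]]
      by (simp add: power2_eq_square)
    moreover have "d \<le> ip (\<lambda>x. 1/2 * ?s x) (\<lambda>x. 1/2 * ?s x)"
      using d_le[OF mid[OF F[of m] F[of n]]] by simp
    ultimately have "4 * d \<le> ip (F m) (F m) + 2 * ip (F m) (F n) + ip (F n) (F n)"
      using ip_add_scale[OF FH[of m] FH[of n], of 1] by simp
    then show ?thesis
      using ip_add_scale[OF FH[of m] FH[of n], of "-1"] Fd[of m] Fd[of n] by simp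
  qed
  have "\<exists>f\<in>H. (\<lambda>n. sqrt (ip (\<lambda>x. F n x - f x) (\<lambda>x. F n x - f x))) \<longlonglongrightarrow> 0"
  proof (rule complete[OF FH])
    fix \<epsilon> :: real assume e: "\<epsilon> > 0"
    obtain N where N: "4 / \<epsilon>\<^sup>2 < real N" using reals_Archimedean2 by blast
    then have "4 / \<epsilon>\<^sup>2 < real (Suc N)" by simp
    then have N': "4 / Suc N < \<epsilon>\<^sup>2" using e by (simp add: field_simps)
    have "sqrt (ip (\<lambda>x. F m x - F n x) (\<lambda>x. F m x - F n x)) < \<epsilon>" if "m \<ge> N" "n \<ge> N" for m n
    proof -
      have "2 / Suc m \<le> 2 / Suc N" "2 / Suc n \<le> 2 / Suc N"
        using that by (auto intro!: divide_left_mono)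
      then have "ip (\<lambda>x. F m x - F n x) (\<lambda>x. F m x - F n x) < \<epsilon>\<^sup>2"
        using para[of m n] N' by simp
      then show ?thesis using e by (intro real_less_lsqrt) auto
    qed
    then show "\<exists>N. \<forall>m\<ge>N. \<forall>n\<ge>N. sqrt (ip (\<lambda>x. F m x - F n x) (\<lambda>x. F m x - F n x)) < \<epsilon>"
      by blast
  qed
  then obtain f where f: "f \<in> H"
    and lim: "(\<lambda>n. sqrt (ip (\<lambda>x. F n x - f x) (\<lambda>x. F n x - f x))) \<longlonglongrightarrow> 0" by blast
  have "ip f f \<le> d + 0"
  proof (rule LIMSEQ_le[OF ip_self_tendsto[OF FH f lim]])
    show "(\<lambda>n. d + 1 / Suc n) \<longlonglongrightarrow> d + 0"
      by (intro tendsto_intros LIMSEQ_Suc[OF lim_1_over_n])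
  qed (use Fd less_imp_le in blast)
  then have "\<And>g. g \<in> A \<Longrightarrow> ip f f \<le> ip g g" using d_le by force
  with closed[OF F f lim] show thesis by (rule that)
qed

end

section \<open>Point evaluations and minimal-norm representatives\<close>

context rkhs
begin

text \<open>Evaluation at \<open>x\<close> is the inner product with the kernel section at
  \<open>x\<close>, hence continuous for the norm of \<open>H\<close>.\<close>

lemma eval_tendsto:
  assumes "\<And>n. F n \<in> H" "f \<in> H" "x \<in> E"
    and "(\<lambda>n. sqrt (ip (\<lambda>x. F n x - f x) (\<lambda>x. F n x - f x))) \<longlonglongrightarrow> 0"
  shows "(\<lambda>n. F n x) \<longlonglongrightarrow> f x"
  using ip_tendsto[OF assms(1,2) section_mem[OF assms(3)] assms(4)]
  by (simp add: reproducing assms)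

text \<open>The representative is the element of least norm among those agreeing with
  \<open>h\<close> on \<open>V\<close>. This affine set is closed because evaluations are
  continuous, and minimality forces orthogonality to its directions, the functions vanishing on
  \<open>V\<close>.\<close>

lemma representative_exists:
  assumes V: "V \<subseteq> E" and h: "h \<in> H"
  obtains f where "f \<in> H" "\<And>v. v \<in> V \<Longrightarrow> f v = h v"
    "\<And>g. g \<in> H \<Longrightarrow> (\<And>v. v \<in> V \<Longrightarrow> g v = 0) \<Longrightarrow> ip f g = 0"
proof -
  let ?A = "{g \<in> H. \<forall>v\<in>V. g v = h v}"
  obtain f where f: "f \<in> ?A" and min: "\<And>g. g \<in> ?A \<Longrightarrow> ip f f \<le> ip g g"
  proof (rule min_norm_exists[of ?A])
    show "?A \<subseteq> H" "?A \<noteq> {}" using h by auto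
    show "(\<lambda>x. (f x + g x) / 2) \<in> ?A" if "f \<in> ?A" "g \<in> ?A" for f g
      using that scale_mem[OF add_mem, of f g "1/2"] by simp
    show "f \<in> ?A" if F: "\<And>n. F n \<in> ?A" and f: "f \<in> H"
      and lim: "(\<lambda>n. sqrt (ip (\<lambda>x. F n x - f x) (\<lambda>x. F n x - f x))) \<longlonglongrightarrow> 0" for F f
    proof -
      have "f v = h v" if "v \<in> V" for v
      proof -
        have "(\<lambda>n. F n v) \<longlonglongrightarrow> f v"
          using F f that V by (intro eval_tendsto[OF _ _ _ lim]) auto
        moreover have "F n v = h v" for n using F that by auto
        ultimately show ?thesis by (simp add: LIMSEQ_const_iff)
      qed
      with f show ?thesis by simp
    qed
  qed blast
  show thesis
  proof (rule that)
    show fH: "f \<in> H" and "\<And>v. v \<in> V \<Longrightarrow> f v = h v" using f by auto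
    fix g assume g: "g \<in> H" and g0: "\<And>v. v \<in> V \<Longrightarrow> g v = 0"
    \<comment> \<open>The summand 1 keeps the denominator positive even when
      \<open>ip g g = 0\<close>, so no case distinction is needed.\<close>
    define t where "t = - ip f g / (1 + ip g g)"
    have p: "0 < 1 + ip g g" using ip_nonneg[OF g] by simp
    have "(\<lambda>x. f x + t * g x) \<in> ?A"
      using f g0 add_mem[OF fH scale_mem[OF g]] by auto
    then have "0 \<le> 2 * t * ip f g + t\<^sup>2 * ip g g"
      using min ip_add_scale[OF fH g, of t] by fastforce
    also have "\<dots> \<le> 2 * t * ip f g + t\<^sup>2 * (1 + ip g g)"
      by (intro add_left_mono mult_left_mono) auto
    also have "\<dots> = - ((ip f g)\<^sup>2) / (1 + ip g g)"
      using p by (simp add: t_def divide_simps) (simp add: algebra_simps power2_eq_square)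
    finally have "(ip f g)\<^sup>2 \<le> 0"
      using p by (simp only: zero_le_divide_iff) auto
    then show "ip f g = 0" by simp
  qed
qed

end

section \<open>Pulling back a reproducing kernel Hilbert space\<close>

text \<open>Composition with \<open>p\<close> is a linear bijection from the orthogonal complement
  \<open>M\<close> of its null space \<open>N\<close> in \<open>H\<close> onto the image of
  \<open>H\<close>. Transporting the inner product along it makes the image a Hilbert space.\<close>

lemma rkhs_pullback:
  fixes p :: "'a \<Rightarrow> 'b"
  assumes "rkhs W k H ip" and p: "p ` X \<subseteq> W"
  shows "\<exists>ip'. rkhs X (\<lambda>x y. k (p x) (p y)) ((\<lambda>h. zero_ext X (\<lambda>x. h (p x))) ` H) ip'"
proof -
  interpret rkhs W k H ip by fact
  define T where "T h = zero_ext X (\<lambda>x. h (p x))" for h :: "'b \<Rightarrow> real"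
  define N where "N = {g \<in> H. \<forall>v\<in>p ` X. g v = 0}"
  define M where "M = {f \<in> H. \<forall>g\<in>N. ip f g = 0}"
  have MH: "f \<in> H" if "f \<in> M" for f using that by (simp add: M_def)
  have T_add: "T (\<lambda>x. f x + g x) = (\<lambda>x. T f x + T g x)" for f g
    by (auto simp: T_def zero_ext_def)
  have T_diff: "T (\<lambda>x. f x - g x) = (\<lambda>x. T f x - T g x)" for f g
    by (auto simp: T_def zero_ext_def)
  have T_scale: "T (\<lambda>x. c * f x) = (\<lambda>x. c * T f x)" for c f
    by (auto simp: T_def zero_ext_def)
  have T_zero: "T (\<lambda>x. 0) = (\<lambda>x. 0)"
    by (auto simp: T_def zero_ext_def)
  have T_eq_iff: "T f = T g \<longleftrightarrow> (\<forall>x\<in>X. f (p x) = g (p x))" for f g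
    by (auto simp: T_def zero_ext_def fun_eq_iff)
  have NH: "g \<in> H" if "g \<in> N" for g using that by (simp add: N_def)
  have M_zero: "(\<lambda>_. 0) \<in> M"
    using zero_mem ip_zero_right NH by (simp add: M_def) (metis ip_commute)
  have M_add: "(\<lambda>x. f x + g x) \<in> M" if "f \<in> M" "g \<in> M" for f g
    using that NH by (auto simp: M_def ip_add_left add_mem)
  have M_diff: "(\<lambda>x. f x - g x) \<in> M" if "f \<in> M" "g \<in> M" for f g
    using that NH by (auto simp: M_def ip_diff_left diff_mem)
  have M_scale: "(\<lambda>x. c * f x) \<in> M" if "f \<in> M" for c f
    using that NH by (auto simp: M_def ip_scale_left scale_mem)
  \<comment> \<open>If \<open>T f = T g\<close>, then \<open>f - g\<close> lies in both
    \<open>M\<close> and \<open>N\<close>, so it is orthogonal to itself.\<close>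
  have inj: "inj_on T M"
  proof (rule inj_onI)
    fix f g assume fg: "f \<in> M" "g \<in> M" and "T f = T g"
    then have "(\<lambda>x. f x - g x) \<in> N"
      using diff_mem MH by (auto simp: N_def T_eq_iff)
    then have "ip (\<lambda>x. f x - g x) (\<lambda>x. f x - g x) = 0"
      using M_diff[OF fg] by (simp add: M_def)
    then have "(\<lambda>x. f x - g x) = (\<lambda>_. 0)"
      using ip_eq_0 diff_mem MH fg by blast
    then show "f = g" by (simp add: fun_eq_iff)
  qed
  have TM: "T ` H = T ` M"
  proof
    show "T ` M \<subseteq> T ` H" using MH by auto
    show "T ` H \<subseteq> T ` M"
    proof safe
      fix h assume "h \<in> H"
      from representative_exists[OF p this] obtain f
        where "f \<in> H" "\<And>v. v \<in> p ` X \<Longrightarrow> f v = h v"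
        "\<And>g. g \<in> H \<Longrightarrow> (\<And>v. v \<in> p ` X \<Longrightarrow> g v = 0) \<Longrightarrow> ip f g = 0" by blast
      then have "f \<in> M" "T h = T f" by (auto simp: M_def N_def T_eq_iff)
      then show "T h \<in> T ` M" by blast
    qed
  qed
  define R where "R = inv_into M T"
  have RT: "R (T f) = f" if "f \<in> M" for f
    using inj that by (simp add: R_def)
  \<comment> \<open>The reproducing property turns the inner product of this section with
    \<open>g\<close> into \<open>g (p x)\<close>, which is 0 for \<open>g\<close> in
    \<open>N\<close>. Being in \<open>M\<close>, the section is the representative of the
    pulled-back section.\<close>
  have sec: "zero_ext W (\<lambda>y. k y (p x)) \<in> M"
    and T_sec: "T (zero_ext W (\<lambda>y. k y (p x))) = zero_ext X (\<lambda>y. k (p y) (p x))"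
    if "x \<in> X" for x
  proof -
    have px: "p x \<in> W" using p that by auto
    have "ip (zero_ext W (\<lambda>y. k y (p x))) g = 0" if "g \<in> N" for g
      using reproducing[OF NH[OF that] px] ip_commute[OF NH[OF that] section_mem[OF px]]
        \<open>x \<in> X\<close> that by (simp add: N_def)
    then show "zero_ext W (\<lambda>y. k y (p x)) \<in> M"
      using section_mem[OF px] by (simp add: M_def)
    show "T (zero_ext W (\<lambda>y. k y (p x))) = zero_ext X (\<lambda>y. k (p y) (p x))"
      using p by (force simp: T_def zero_ext_def fun_eq_iff)
  qed
  have "rkhs X (\<lambda>x y. k (p x) (p y)) (T ` M) (\<lambda>f g. ip (R f) (R g))"
  proof (unfold_locales, goal_cases)
    case 1
    then show ?case by (auto simp: functions_on_def T_def zero_ext_def)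
  next
    case 2
    then show ?case using M_zero T_zero by (metis imageI)
  next
    case (3 f g)
    then show ?case using M_add T_add by (auto simp: image_iff) metis
  next
    case (4 f c)
    then show ?case using M_scale T_scale by (auto simp: image_iff) metis
  next
    case (5 f g)
    then show ?case by (auto simp: RT MH intro: ip_commute)
  next
    case (6 f g h)
    then show ?case
      by (auto simp: RT MH M_add ip_add_left simp flip: T_add)
  next
    case (7 f g c)
    then show ?case
      by (auto simp: RT MH M_scale ip_scale_left simp flip: T_scale)
  next
    case (8 f)
    then show ?case by (auto simp: RT MH ip_nonneg)
  next
    case (9 f)
    then obtain g where "g \<in> M" "f = T g" by auto
    with 9(2) have "g = (\<lambda>_. 0)" by (intro ip_eq_0 MH) (simp_all add: RT)
    with \<open>f = T g\<close> show ?case by (simp add: T_zero)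
  next
    \<comment> \<open>Completeness: the representatives \<open>G n\<close> form a Cauchy sequence in
      \<open>H\<close>, and their limit stays in \<open>M\<close> because orthogonality to
      \<open>N\<close> survives weak limits.\<close>
    case (10 F)
    define G where "G n = R (F n)" for n
    have G: "G n \<in> M" "F n = T (G n)" for n
      using 10(1)[of n] by (auto simp: G_def RT)
    have R_diff: "R (\<lambda>x. T f x - T g x) = (\<lambda>x. f x - g x)" if "f \<in> M" "g \<in> M" for f g
      using RT[OF M_diff[OF that]] by (simp add: T_diff)
    have "\<exists>f\<in>H. (\<lambda>n. sqrt (ip (\<lambda>x. G n x - f x) (\<lambda>x. G n x - f x))) \<longlonglongrightarrow> 0"
      using 10(2) by (intro complete MH G) (simp add: G(2) R_diff[OF G(1) G(1)])
    then obtain f where f: "f \<in> H"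
      and lim: "(\<lambda>n. sqrt (ip (\<lambda>x. G n x - f x) (\<lambda>x. G n x - f x))) \<longlonglongrightarrow> 0" by blast
    have "ip f g = 0" if "g \<in> N" for g
    proof -
      have "(\<lambda>n. ip (G n) g) \<longlonglongrightarrow> ip f g"
        using MH[OF G(1)] f NH[OF that] lim by (rule ip_tendsto)
      moreover have "ip (G n) g = 0" for n using G(1)[of n] that by (simp add: M_def)
      ultimately show ?thesis by (simp add: LIMSEQ_const_iff)
    qed
    then have fM: "f \<in> M" using f by (simp add: M_def)
    then show ?case
      using lim by (intro bexI[of _ "T f"]) (simp_all add: G(2) R_diff[OF G(1) fM])
  next
    case (11 x)
    then show ?case using sec T_sec by (metis imageI)
  next
    case (12 h x)
    then obtain f where f: "f \<in> M" "h = T f" by auto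
    have "p x \<in> W" using p 12 by auto
    then have "ip f (zero_ext W (\<lambda>y. k y (p x))) = f (p x)"
      using reproducing MH f by blast
    then show ?case
      using f RT[OF sec[OF 12(2)]] 12(2) by (simp add: RT T_sec) (simp add: T_def zero_ext_def)
  qed
  then show ?thesis unfolding TM[symmetric] by (auto simp: T_def)
qed

section \<open>Universality of the pulled-back kernel\<close>

lemma kernel_on_pullback:
  assumes "kernel_on W k" "p ` X \<subseteq> W"
  shows "kernel_on X (\<lambda>x y. k (p x) (p y))"
  unfolding kernel_on_def
proof (intro conjI ballI allI impI)
  fix x y assume "x \<in> X" "y \<in> X"
  then have "p x \<in> W" "p y \<in> W" using assms(2) by auto
  then show "k (p x) (p y) = k (p y) (p x)" using assms(1) by (simp add: kernel_on_def)
next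
  fix n :: nat and x a assume "1 \<le> n" and "\<forall>i\<in>{1..n}. x i \<in> X"
  then have "\<forall>i\<in>{1..n}. (p \<circ> x) i \<in> W" using assms(2) by auto
  then have "0 \<le> (\<Sum>i=1..n. \<Sum>j=1..n. a i * k ((p \<circ> x) i) ((p \<circ> x) j) * a j)"
    using assms(1) \<open>1 \<le> n\<close> unfolding kernel_on_def by blast
  then show "0 \<le> (\<Sum>i=1..n. \<Sum>j=1..n. a i * k (p (x i)) (p (x j)) * a j)" by simp
qed

text \<open>Injectivity of \<open>p\<close> enters through \<open>sep\<close>, phrased with
  continuous functions on \<open>W\<close> so that it directly supplies the point separation in
  Stone-Weierstrass.\<close>

lemma universal_kernel_pullback:
  fixes p :: "'a::metric_space \<Rightarrow> 'b::metric_space"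
  assumes "X \<noteq> {}" "compact X" "compact W" and p: "p ` X \<subseteq> W" and cp: "continuous_on X p"
    and sep: "\<And>x y. x \<in> X \<Longrightarrow> y \<in> X \<Longrightarrow> x \<noteq> y \<Longrightarrow>
        \<exists>g. continuous_on W g \<and> g (p x) \<noteq> (g (p y) :: real)"
    and univ: "universal_kernel W k"
  shows "universal_kernel X (\<lambda>x y. k (p x) (p y))"
proof -
  from univ obtain H ip where ker: "kernel_on W k"
    and cont: "continuous_on (W \<times> W) (\<lambda>(x, y). k x y)"
    and rk: "rkhs W k H ip" and dense: "dense_in_C W H"
    by (auto simp: universal_kernel_def)
  define T where "T h = zero_ext X (\<lambda>x. h (p x))" for h :: "'b \<Rightarrow> real"
  have comp: "continuous_on X (\<lambda>x. g (p x))" if "continuous_on W g" for g :: "'b \<Rightarrow> real"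
    by (rule continuous_on_compose2[OF that cp p])
  have HC: "continuous_on W h" if "h \<in> H" for h
    using dense that by (auto simp: dense_in_C_def C_on_def)
  have sub: "T ` H \<subseteq> C_on X"
  proof safe
    fix h assume "h \<in> H"
    then have "continuous_on X (T h)"
      using comp[OF HC] by (auto simp: T_def zero_ext_def cong: continuous_on_cong)
    then show "T h \<in> C_on X"
      by (auto simp: C_on_def functions_on_def T_def zero_ext_def)
  qed
  let ?R = "(\<lambda>g x. g (p x)) ` {g :: 'b \<Rightarrow> real. continuous_on W g}"
  interpret function_ring_on ?R X
  proof
    show "f \<in> ?R \<Longrightarrow> continuous_on X f" for f
      using comp by auto
    show "f \<in> ?R \<Longrightarrow> g \<in> ?R \<Longrightarrow> (\<lambda>x. f x + g x) \<in> ?R" for f g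
      by (auto intro!: image_eqI[where x = "\<lambda>w. _ w + _ w"] continuous_intros)
    show "f \<in> ?R \<Longrightarrow> g \<in> ?R \<Longrightarrow> (\<lambda>x. f x * g x) \<in> ?R" for f g
      by (auto intro!: image_eqI[where x = "\<lambda>w. _ w * _ w"] continuous_intros)
    show "(\<lambda>_. c) \<in> ?R" for c
      by (auto intro!: image_eqI[where x = "\<lambda>w. c"])
    show "\<exists>f\<in>?R. f x \<noteq> f y" if "x \<in> X" "y \<in> X" "x \<noteq> y" for x y
      using sep[OF that] by auto
  qed (fact \<open>compact X\<close>)
  have "\<exists>h\<in>T ` H. sup_norm_on X (\<lambda>x. f x - h x) < \<epsilon>" if f: "f \<in> C_on X" and e: "\<epsilon> > 0" for f \<epsilon>
  proof -
    have "continuous_on X f" using f by (simp add: C_on_def)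
    \<comment> \<open>Two errors of \<open>\<epsilon>/3\<close> arise, from Stone-Weierstrass on
      \<open>X\<close> and from density on \<open>W\<close>. The spare third restores strictness,
      since a pointwise bound gives only \<le> for the supremum.\<close>
    from Stone_Weierstrass_basic[OF this, of "\<epsilon>/3"] e obtain g
      where g: "continuous_on W g" and fg: "\<And>x. x \<in> X \<Longrightarrow> \<bar>f x - g (p x)\<bar> < \<epsilon>/3"
      by auto
    \<comment> \<open>Density concerns members of \<open>C_on W\<close>, which vanish off
      \<open>W\<close>, so \<open>g\<close> is replaced by its zero extension.\<close>
    have "continuous_on W (zero_ext W g)"
      using g by (auto simp: zero_ext_def cong: continuous_on_cong)
    then have "zero_ext W g \<in> C_on W"
      by (auto simp: C_on_def functions_on_def zero_ext_def)
    then obtain h where h: "h \<in> H" and gh: "sup_norm_on W (\<lambda>w. zero_ext W g w - h w) < \<epsilon>/3"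
      using dense e unfolding dense_in_C_def by (meson divide_pos_pos zero_less_numeral)
    have "bounded ((\<lambda>w. \<bar>zero_ext W g w - h w\<bar>) ` W)"
      by (intro compact_imp_bounded compact_continuous_image continuous_intros HC[OF h]) fact+
    then have bdd: "bdd_above ((\<lambda>w. \<bar>zero_ext W g w - h w\<bar>) ` W)"
      by (rule bounded_imp_bdd_above)
    have "\<bar>f x - T h x\<bar> \<le> 2 * (\<epsilon>/3)" if x: "x \<in> X" for x
    proof -
      have px: "p x \<in> W" using p x by auto
      have "\<bar>g (p x) - h (p x)\<bar> \<le> sup_norm_on W (\<lambda>w. zero_ext W g w - h w)"
        using cSUP_upper[OF px bdd] px by (simp add: sup_norm_on_def zero_ext_def)
      moreover have "T h x = h (p x)" using x by (simp add: T_def zero_ext_def)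
      ultimately show ?thesis
        using fg[OF x] gh by linarith
    qed
    then have "sup_norm_on X (\<lambda>x. f x - T h x) \<le> 2 * (\<epsilon>/3)"
      unfolding sup_norm_on_def by (intro cSUP_least \<open>X \<noteq> {}\<close>)
    then show ?thesis using h e by force
  qed
  with sub have "dense_in_C X (T ` H)" by (simp add: dense_in_C_def)
  moreover have "\<exists>ip'. rkhs X (\<lambda>x y. k (p x) (p y)) (T ` H) ip'"
    using rkhs_pullback[OF rk p] by (simp add: T_def)
  moreover have "continuous_on (X \<times> X) (\<lambda>(x, y). k (p x) (p y))"
  proof -
    have "continuous_on (X \<times> X) (\<lambda>z. (p (fst z), p (snd z)))"
      by (intro continuous_intros continuous_on_compose2[OF cp]) auto
    moreover have "(\<lambda>z. (p (fst z), p (snd z))) ` (X \<times> X) \<subseteq> W \<times> W" using p by auto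
    ultimately show ?thesis
      using continuous_on_compose2[OF cont] by (force simp: case_prod_unfold)
  qed
  ultimately show ?thesis
    using kernel_on_pullback[OF ker p] by (auto simp: universal_kernel_def)
qed

section \<open>The embedding\<close>

text \<open>A coordinate is bounded by the norm. The coordinates are the functions that will
  separate the points of the image of \<open>phi\<close>.\<close>

lemma continuous_on_ell2_nth: "continuous_on A (\<lambda>w. ell2_nth w n)"
proof (rule lipschitz_on_continuous_on)
  show "1-lipschitz_on A (\<lambda>w. ell2_nth w n)"
    using abs_ell2_nth_le_norm[of "_ - _" n]
    by (intro lipschitz_onI) (auto simp: dist_real_def dist_norm minus_ell2.rep_eq)
qed

text \<open>The constant \<^const>\<open>c_phi\<close> normalises the geometric series: \<open>c\<^sup>2 \<Sum>\<^sub>n q\<^sup>-\<^sup>2\<^sup>n = 1\<close>.\<close>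

lemma dist_phi_le:
  fixes xs :: "nat \<Rightarrow> 'a::metric_space"
  assumes b: "bounded (range xs)" and q: "q > 1"
  shows "dist (phi q xs x) (phi q xs y) \<le> dist x y"
proof -
  have q2: "1 < q\<^sup>2" using q by (simp add: one_less_power)
  have c2: "(c_phi q)\<^sup>2 = 1 - 1 / q\<^sup>2"
    using q q2 by (simp add: c_phi_def power_divide diff_divide_distrib)
  let ?a = "\<lambda>n. (ell2_nth (phi q xs x) n - ell2_nth (phi q xs y) n)\<^sup>2"
  have "(\<lambda>n. (c_phi q)\<^sup>2 * (dist x y)\<^sup>2 * (1 / q\<^sup>2) ^ n)
      sums ((c_phi q)\<^sup>2 * (dist x y)\<^sup>2 * (1 / (1 - 1 / q\<^sup>2)))"
    using q2 by (intro sums_mult geometric_sums) (simp add: divide_less_eq)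
  then have s: "(\<lambda>n. (c_phi q)\<^sup>2 * (dist x y)\<^sup>2 * (1 / q\<^sup>2) ^ n) sums (dist x y)\<^sup>2"
    using q2 by (simp add: c2)
  \<comment> \<open>The reverse triangle inequality bounds each coordinate difference by a term of
    the geometric series.\<close>
  have le: "?a n \<le> (c_phi q)\<^sup>2 * (dist x y)\<^sup>2 * (1 / q\<^sup>2) ^ n" for n
  proof -
    have "\<bar>dist x (xs n) - dist y (xs n)\<bar> \<le> dist x y"
      using abs_dist_diff_le[of x "xs n" y] by (simp add: dist_commute)
    then have "(dist x (xs n) - dist y (xs n))\<^sup>2 \<le> (dist x y)\<^sup>2"
      using abs_le_square_iff by fastforce
    then have "(c_phi q)\<^sup>2 * (dist x (xs n) - dist y (xs n))\<^sup>2 * (1 / q\<^sup>2) ^ n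
        \<le> (c_phi q)\<^sup>2 * (dist x y)\<^sup>2 * (1 / q\<^sup>2) ^ n"
      by (intro mult_right_mono mult_left_mono) auto
    moreover have "?a n = (c_phi q * (dist x (xs n) - dist y (xs n)) / q ^ n)\<^sup>2"
      by (simp add: ell2_nth_phi[OF b q] diff_divide_distrib right_diff_distrib)
    moreover have "(q ^ n)\<^sup>2 = (q\<^sup>2) ^ n"
      by (simp add: mult.commute flip: power_mult)
    ultimately show ?thesis
      by (simp add: power_mult_distrib power_divide)
  qed
  have "summable ?a"
    using summable_ell2_nth[of "phi q xs x - phi q xs y"] by (simp add: minus_ell2.rep_eq)
  then have "(\<Sum>n. ?a n) \<le> (dist x y)\<^sup>2"
    using sums_le[OF le summable_sums s] by simp
  then show ?thesis
    unfolding dist_ell2_eq by (intro real_le_lsqrt) auto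
qed

theorem theorem6:
  fixes X :: "'a::metric_space set"
    and xs :: "nat \<Rightarrow> 'a"
    and q :: real
    and W :: "ell2 set"
    and kW :: "ell2 \<Rightarrow> ell2 \<Rightarrow> real"
  assumes "X \<noteq> {}" and "compact X" and "diameter X > 0"
    and "is_basis X xs"
    and "q > 1"
    and "compact W" and "phi q xs ` X \<subseteq> W"
    and "universal_kernel W kW"
  shows "universal_kernel X (\<lambda>x y. kW (phi q xs x) (phi q xs y))"
proof (rule universal_kernel_pullback[OF assms(1,2,6,7) _ _ assms(8)])
  have b: "bounded (range xs)"
    using assms(2,4) bounded_subset compact_imp_bounded by (auto simp: is_basis_def)
  have "1-lipschitz_on X (phi q xs)"
    using dist_phi_le[OF b assms(5)] by (intro lipschitz_onI) auto
  then show "continuous_on X (phi q xs)" by (rule lipschitz_on_continuous_on)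
  fix x y assume "x \<in> X" "y \<in> X" "x \<noteq> y"
  \<comment> \<open>Any factor below one half works: equal distances from \<open>x\<close> and
    \<open>y\<close> to \<open>xs n\<close> would give \<open>dist x y\<close> \<le>
    \<open>2 * dist x (xs n)\<close> < \<open>dist x y\<close>.\<close>
  then obtain n where n: "dist x (xs n) \<le> dist x y / 3"
    using assms(4) unfolding is_basis_def
    by (meson divide_pos_pos zero_less_dist_iff zero_less_numeral)
  have "0 < dist x y" using \<open>x \<noteq> y\<close> by simp
  then have "dist x (xs n) \<noteq> dist y (xs n)"
    using n dist_triangle2[of x y "xs n"] by linarith
  moreover have "c_phi q > 0"
    using assms(5) by (simp add: c_phi_def one_less_power)
  ultimately have "ell2_nth (phi q xs x) n \<noteq> ell2_nth (phi q xs y) n"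
    using assms(5) by (simp add: ell2_nth_phi[OF b assms(5)])
  then show "\<exists>g. continuous_on W g \<and> g (phi q xs x) \<noteq> (g (phi q xs y) :: real)"
    using continuous_on_ell2_nth by (intro exI[of _ "\<lambda>w. ell2_nth w n"]) simp
qed

end
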